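(* Let $a,b$ be coprime positive integers. Then $$ c(q^b,t;a,b)=\frac{t^{b-1}-1}{t-1}+\frac{q^b-1}{b}\sum_{j=0}^{b-1}d_j(q,t;a,b)\,C_{S_{a,b}}(\epsilon_b^jq). $$
   Context: For coprime positive integers $a,b$, $S_{a,b}=\{xa+yb: x,y\in\mathbb Z_{\ge 0}\}$ is the numerical semigroup generated by $a$ and $b$, $C_{S_{a,b}}:=\mathbb Z_{\ge 0}\setminus S_{a,b}$ (a finite set), and $C_{S_{a,b}}(q):=\sum_{k\in C_{S_{a,b}}}q^k$. $\epsilon_b:=e^{2\pi i/b}$ with $i=\sqrt{-1}$, and $[x]$ is the integer part (floor) of $x$. The Dedekind-Carlitz polynomials are $c(q,t;a,b):=\sum_{k=1}^{b-1}q^{[ak/b]}t^{k-1}$; thus $c(q^b,t;a,b)$ is obtained by substituting $q^b$ for $q$. For $k\in\{0,1,\dots,b-1\}$, $\pi(k)\in\{0,1,\dots,b-1\}$ is the remainder of $ak$ modulo $b$, and $$d_j(q,t;a,b):=\sum_{k=1}^{b-1}\frac{\epsilon_b^{-jak}t^{k-1}}{q^{\pi(k)}}.$$ The identity is an identity of rational functions in the variables $q,t$ with complex coefficients. *)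

theory Defs
  imports
    Complex_Main
    "HOL-Computational_Algebra.Polynomial"
    "HOL-Computational_Algebra.Fraction_Field"
    "HOL-Number_Theory.Cong"
begin

text \<open>
  The field \<open>\<complex>(q, t)\<close> is realised as the fraction field of \<open>\<complex>[q][t]\<close>: the inner polynomial
  variable is \<open>q\<close>, the outer one is \<open>t\<close>.
\<close>

type_synonym ratfun = "complex poly poly fract"

definition const_rf :: "complex \<Rightarrow> ratfun" where
  "const_rf z = Fract [:[:z:]:] 1"

definition q_rf :: ratfun where
  "q_rf = Fract [:[:0, 1:]:] 1"

definition t_rf :: ratfun where
  "t_rf = Fract [:0, 1:] 1"

definition root_eps :: "nat \<Rightarrow> complex" where
  "root_eps b = exp (2 * complex_of_real pi * \<i> / of_nat b)"

definition num_semigroup :: "nat \<Rightarrow> nat \<Rightarrow> nat set" where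
  "num_semigroup a b = {x * a + y * b | x y. True}"

definition gap_set :: "nat \<Rightarrow> nat \<Rightarrow> nat set" where
  "gap_set a b = UNIV - num_semigroup a b"

text \<open>
  The polynomials below are functions of their variables with values in an arbitrary ring,
  so that substitution (\<open>q\<^sup>b\<close> or \<open>\<epsilon>\<^sub>b\<^sup>j q\<close> for \<open>q\<close>) is application. The sum over the gaps is a
  genuine finite sum for coprime positive \<open>a\<close>, \<open>b\<close>, see \<open>finite_gap_set\<close>.
\<close>

definition gap_poly :: "nat \<Rightarrow> nat \<Rightarrow> 'a::comm_semiring_1 \<Rightarrow> 'a" where
  "gap_poly a b q = (\<Sum>k\<in>gap_set a b. q ^ k)"

definition dedekind_carlitz :: "'a::comm_semiring_1 \<Rightarrow> 'a \<Rightarrow> nat \<Rightarrow> nat \<Rightarrow> 'a" where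
  "dedekind_carlitz q t a b =
     (\<Sum>k = 1..b - 1. q ^ nat \<lfloor>real (a * k) / real b\<rfloor> * t ^ (k - 1))"

definition rem_pi :: "nat \<Rightarrow> nat \<Rightarrow> nat \<Rightarrow> nat" where
  "rem_pi a b k = (a * k) mod b"

definition d_sum :: "nat \<Rightarrow> ratfun \<Rightarrow> ratfun \<Rightarrow> nat \<Rightarrow> nat \<Rightarrow> ratfun" where
  "d_sum j q t a b =
     (\<Sum>k = 1..b - 1.
        const_rf (root_eps b powi (- int (j * a * k))) * t ^ (k - 1) / q ^ rem_pi a b k)"

lemma finite_gap_set:
  assumes "a > 0" "b > 0" "coprime a b"
  shows "finite (gap_set a b)"
proof (rule finite_subset)
  show "gap_set a b \<subseteq> {..<a * b}"
  proof
    fix n assume n: "n \<in> gap_set a b"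
    show "n \<in> {..<a * b}"
    proof (rule ccontr)
      assume "n \<notin> {..<a * b}"
      hence ge: "a * b \<le> n" by simp
      obtain u :: int where "(int a * u) mod int b = 1 mod int b"
        using assms(3) cong_solve_coprime_int[of "int a" "int b"]
        by (auto simp: cong_def)
      hence u: "[int a * u = 1] (mod int b)" by (simp add: cong_def)
      define x where "x = nat ((u * int n) mod int b)"
      have xlt: "x < b" using assms(2) by (simp add: x_def nat_less_iff)
      have xi: "int x = (u * int n) mod int b" using assms(2) by (simp add: x_def)
      have "[int x * int a = (u * int n) * int a] (mod int b)"
        unfolding xi by (simp add: cong_def mod_simps)
      also have "(u * int n) * int a = (int a * u) * int n" by simp
      also have "[(int a * u) * int n = 1 * int n] (mod int b)"
        by (rule cong_mult[OF u cong_refl])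
      finally have "[int (x * a) = int n] (mod int b)" by simp
      hence cn: "[n = x * a] (mod b)" by (simp only: cong_int_iff cong_sym_eq)
      have le: "x * a \<le> n"
        using ge xlt by (metis le_trans less_imp_le mult.commute mult_le_mono1)
      hence "b dvd n - x * a" using cn by (simp add: cong_altdef_nat)
      then obtain y where "n - x * a = b * y" by (elim dvdE)
      hence "n = x * a + y * b" using le by (simp add: mult.commute)
      hence "n \<in> num_semigroup a b" by (auto simp: num_semigroup_def)
      thus False using n by (simp add: gap_set_def)
    qed
  qed
qed simp

end

theory Submission
  imports Defs "HOL-Analysis.Complex_Transcendental"
begin

text \<open>
  Exchanging the sums over \<open>j\<close> and \<open>k\<close> on the right-hand side makes the inner sum over \<open>j\<close> a
  filter by the \<open>b\<close>-th roots of unity (\<open>gap_poly_root_filter\<close>): from the gap polynomial it extracts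
  \<open>b\<close> times the sum of \<open>q ^ g\<close> over the gaps \<open>g \<equiv> a * k (mod b)\<close>. Now \<open>a * k\<close> with \<open>k < b\<close> is the
  smallest element of the semigroup in its residue class, so these gaps are precisely the numbers
  \<open>\<pi>(k) + b * m\<close> with \<open>m < \<lfloor>a * k / b\<rfloor>\<close> (\<open>gaps_in_residue_class\<close>). The sum is therefore
  geometric, with value \<open>q ^ \<pi>(k) * (q ^ (b * \<lfloor>a * k / b\<rfloor>) - 1) / (q ^ b - 1)\<close>, and the factors
  in front of it cancel down to \<open>q ^ (b * \<lfloor>a * k / b\<rfloor>) - 1\<close>. Weighted by \<open>t ^ (k - 1)\<close> and summed
  over \<open>k\<close>, the first term gives the Dedekind-Carlitz polynomial, and the \<open>-1\<close> gives the
  geometric sum in \<open>t\<close>.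
\<close>

section \<open>The ratios and powers in the field of rational functions\<close>

lemma const_rf_1: "const_rf 1 = 1"
  by (simp add: const_rf_def One_fract_def flip: one_pCons)

lemma const_rf_0: "const_rf 0 = 0"
  by (simp add: const_rf_def Zero_fract_def)

lemma const_rf_add: "const_rf (x + y) = const_rf x + const_rf y"
  by (simp add: const_rf_def)

lemma const_rf_mult: "const_rf (x * y) = const_rf x * const_rf y"
  by (simp add: const_rf_def)

lemma const_rf_power: "const_rf (x ^ n) = const_rf x ^ n"
  by (induction n) (simp_all add: const_rf_1 const_rf_mult)

lemma const_rf_sum: "const_rf (sum f A) = (\<Sum>x\<in>A. const_rf (f x))"
  by (induction A rule: infinite_finite_induct) (simp_all add: const_rf_0 const_rf_add)

lemma const_rf_of_nat: "const_rf (of_nat n) = of_nat n"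
  by (induction n) (simp_all add: const_rf_0 const_rf_1 const_rf_add)

lemma of_nat_ratfun_nonzero: "n > 0 \<Longrightarrow> (of_nat n :: ratfun) \<noteq> 0"
  by (simp add: const_rf_def eq_fract Zero_fract_def flip: const_rf_of_nat)

lemma t_rf_neq_1: "t_rf \<noteq> 1"
  by (simp add: t_rf_def One_fract_def eq_fract one_pCons)

lemma q_rf_nonzero: "q_rf \<noteq> 0"
  by (simp add: q_rf_def Zero_fract_def eq_fract)

lemma q_rf_power: "q_rf ^ n = Fract [:monom 1 n:] 1"
  by (induction n)
    (simp_all add: q_rf_def One_fract_def monom_Suc flip: one_pCons)

lemma q_rf_power_neq_1:
  assumes "n > 0"
  shows "q_rf ^ n \<noteq> 1"
proof
  assume "q_rf ^ n = 1"
  hence "monom 1 n = (1 :: complex poly)"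
    by (simp add: q_rf_power One_fract_def eq_fract one_pCons)
  hence "degree (monom 1 n :: complex poly) = 0" by simp
  thus False using assms by (simp add: degree_monom_eq)
qed

section \<open>The roots of unity filter\<close>

lemma root_eps_nonzero: "root_eps b \<noteq> 0"
  by (simp add: root_eps_def)

lemma root_eps_power: "root_eps b ^ n = exp (2 * complex_of_real pi * \<i> * of_nat n / of_nat b)"
  by (simp add: root_eps_def field_simps flip: exp_of_nat_mult)

lemma root_eps_filter:
  assumes "b > 0"
  shows "(\<Sum>j<b. root_eps b powi (- int (j * m)) * (root_eps b ^ j) ^ g) =
    (if [g = m] (mod b) then of_nat b else 0)"
proof -
  \<comment> \<open>The \<open>j\<close>-th summand is \<open>z ^ j\<close>, and \<open>z ^ b = 1\<close>, so the geometric sum vanishes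
    unless \<open>z = 1\<close>.\<close>
  define z where "z = root_eps b ^ g / root_eps b ^ m"
  have z_power: "root_eps b powi (- int (j * m)) * (root_eps b ^ j) ^ g = z ^ j" for j
  proof -
    have "root_eps b powi (- int (j * m)) = inverse ((root_eps b ^ m) ^ j)"
      by (simp only: power_int_minus power_int_of_nat power_mult[symmetric] mult.commute[of m j])
    moreover have "(root_eps b ^ j) ^ g = (root_eps b ^ g) ^ j"
      by (simp only: power_mult[symmetric] mult.commute[of g j])
    ultimately show ?thesis
      by (simp only: z_def divide_inverse power_mult_distrib power_inverse mult.commute)
  qed
  have "root_eps b ^ b = 1"
    using assms by (simp add: root_eps_power)
  hence "(root_eps b ^ n) ^ b = 1" for n
    by (metis power_mult power_one mult.commute)
  hence "z ^ b = 1"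
    by (simp add: z_def power_divide)
  moreover have "z = 1 \<longleftrightarrow> [g = m] (mod b)"
    using assms complex_root_unity_eq[of b g m]
    by (simp add: z_def root_eps_nonzero root_eps_power cong_def)
  ultimately show ?thesis
    by (simp only: z_power sum_gp_strict) simp
qed

lemma gap_poly_root_filter:
  assumes "b > 0" "finite (gap_set a b)"
  shows "(\<Sum>j<b. const_rf (root_eps b powi (- int (j * m))) *
      gap_poly a b (const_rf (root_eps b ^ j) * q)) =
    of_nat b * (\<Sum>g | g \<in> gap_set a b \<and> [g = m] (mod b). q ^ g)"
proof -
  have "(\<Sum>j<b. const_rf (root_eps b powi (- int (j * m))) *
      gap_poly a b (const_rf (root_eps b ^ j) * q)) =
    (\<Sum>j<b. \<Sum>g\<in>gap_set a b.
      const_rf (root_eps b powi (- int (j * m)) * (root_eps b ^ j) ^ g) * q ^ g)"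
    by (simp add: gap_poly_def sum_distrib_left power_mult_distrib const_rf_mult const_rf_power
        mult.assoc)
  also have "\<dots> = (\<Sum>g\<in>gap_set a b.
      const_rf (\<Sum>j<b. root_eps b powi (- int (j * m)) * (root_eps b ^ j) ^ g) * q ^ g)"
    by (subst sum.swap) (simp only: const_rf_sum sum_distrib_right)
  also have "\<dots> = (\<Sum>g\<in>gap_set a b. if [g = m] (mod b) then of_nat b * q ^ g else 0)"
    by (intro sum.cong refl)
      (simp only: root_eps_filter[OF assms(1)], simp add: const_rf_of_nat const_rf_0)
  also have "\<dots> = of_nat b * (\<Sum>g | g \<in> gap_set a b \<and> [g = m] (mod b). q ^ g)"
    using assms(2) by (simp add: sum_distrib_left sum.inter_filter if_distrib cong: if_cong)
  finally show ?thesis .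
qed

section \<open>The gaps in a residue class\<close>

text \<open>
  The numbers \<open>a * k\<close> with \<open>k < b\<close> form the Apery set of the semigroup with respect to \<open>b\<close>: if
  \<open>x * a + y * b \<equiv> a * k (mod b)\<close>, then \<open>x \<equiv> k (mod b)\<close> because \<open>a\<close> is invertible, so \<open>x \<ge> k\<close>.
\<close>

lemma mem_num_semigroup_iff:
  assumes "coprime a b" "k < b" "[n = a * k] (mod b)"
  shows "n \<in> num_semigroup a b \<longleftrightarrow> a * k \<le> n"
proof
  assume "n \<in> num_semigroup a b"
  then obtain x y where n: "n = x * a + y * b" by (auto simp: num_semigroup_def)
  hence "[a * x = a * k] (mod b)"
    using assms(3) by (simp add: cong_def mult.commute)
  hence "[x = k] (mod b)"
    using assms(1) by (simp add: cong_mult_lcancel_nat)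
  hence "k \<le> x"
    using assms(2) by (metis cong_def mod_less mod_less_eq_dividend)
  thus "a * k \<le> n"
    unfolding n by (simp add: mult.commute trans_le_add1)
next
  assume le: "a * k \<le> n"
  hence "b dvd n - a * k" using assms(3) by (simp add: cong_altdef_nat)
  then obtain y where "n - a * k = b * y" by (elim dvdE)
  hence "n = k * a + y * b" using le by (simp add: mult.commute)
  thus "n \<in> num_semigroup a b" by (auto simp: num_semigroup_def)
qed

lemma gaps_in_residue_class:
  assumes "coprime a b" "k < b"
  shows "{g \<in> gap_set a b. [g = a * k] (mod b)} =
    (\<lambda>m. rem_pi a b k + b * m) ` {..<a * k div b}" (is "?G = ?I")
proof -
  have b: "b > 0" using assms(2) by simp
  \<comment> \<open>\<open>a * k\<close> has quotient \<open>\<lfloor>a * k / b\<rfloor>\<close> and the same remainder, so comparing with it means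
    comparing quotients.\<close>
  have lt_iff: "rem_pi a b k + b * m < a * k \<longleftrightarrow> m < a * k div b" for m
  proof -
    have "a * k = rem_pi a b k + b * (a * k div b)"
      by (simp add: rem_pi_def)
    thus ?thesis using b by (metis nat_add_left_cancel_less nat_mult_less_cancel1)
  qed
  have gap_iff: "g \<in> ?G \<longleftrightarrow> [g = a * k] (mod b) \<and> g < a * k" for g
    using mem_num_semigroup_iff[OF assms] by (auto simp: gap_set_def not_le)
  show ?thesis
  proof (intro set_eqI iffI)
    fix g assume "g \<in> ?G"
    hence g: "[g = a * k] (mod b)" "g < a * k" by (simp_all only: gap_iff)
    have "g = rem_pi a b k + b * (g div b)"
      using g(1) mod_mult_div_eq[of g b] by (simp add: rem_pi_def cong_def)
    thus "g \<in> ?I" using g(2) lt_iff[of "g div b"] by auto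
  next
    fix g assume "g \<in> ?I"
    then obtain m where m: "g = rem_pi a b k + b * m" "m < a * k div b" by auto
    have "[g = a * k] (mod b)" by (simp add: m(1) rem_pi_def cong_def)
    thus "g \<in> ?G" using m lt_iff[of m] by (simp only: gap_iff)
  qed
qed

lemma gap_sum_residue_class:
  fixes q :: "'a :: field"
  assumes "coprime a b" "k < b" "q ^ b \<noteq> 1"
  shows "(q ^ b - 1) * (\<Sum>g | g \<in> gap_set a b \<and> [g = a * k] (mod b). q ^ g) =
    q ^ rem_pi a b k * ((q ^ b) ^ (a * k div b) - 1)"
proof -
  have "inj_on (\<lambda>m. rem_pi a b k + b * m) {..<a * k div b}"
    using assms(2) by (auto simp: inj_on_def)
  hence "(\<Sum>g | g \<in> gap_set a b \<and> [g = a * k] (mod b). q ^ g) =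
    q ^ rem_pi a b k * (\<Sum>m<a * k div b. (q ^ b) ^ m)"
    by (simp add: gaps_in_residue_class[OF assms(1,2)] sum.reindex power_add power_mult
        sum_distrib_left)
  thus ?thesis using assms(3) by (simp add: geometric_sum)
qed

section \<open>The identity\<close>

theorem mainTheorem3:
  fixes a b :: nat
  assumes "a > 0" and "b > 0" and "coprime a b"
  shows "dedekind_carlitz (q_rf ^ b) t_rf a b =
    (t_rf ^ (b - 1) - 1) / (t_rf - 1) +
    (q_rf ^ b - 1) / of_nat b *
      (\<Sum>j = 0..b - 1. d_sum j q_rf t_rf a b *
         gap_poly a b (const_rf (root_eps b ^ j) * q_rf))"
proof -
  let ?gaps = "\<lambda>k. \<Sum>g | g \<in> gap_set a b \<and> [g = a * k] (mod b). q_rf ^ g"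
  have range: "{0..b - 1} = {..<b}" using assms(2) by auto
  have "(\<Sum>j = 0..b - 1. d_sum j q_rf t_rf a b *
         gap_poly a b (const_rf (root_eps b ^ j) * q_rf)) =
    (\<Sum>k = 1..b - 1. t_rf ^ (k - 1) / q_rf ^ rem_pi a b k *
      (\<Sum>j<b. const_rf (root_eps b powi (- int (j * (a * k)))) *
         gap_poly a b (const_rf (root_eps b ^ j) * q_rf)))"
    unfolding d_sum_def sum_distrib_right range
    by (subst sum.swap) (simp add: sum_distrib_left mult_ac)
  also have "\<dots> = (\<Sum>k = 1..b - 1. t_rf ^ (k - 1) / q_rf ^ rem_pi a b k * (of_nat b * ?gaps k))"
    by (simp only: gap_poly_root_filter[OF assms(2) finite_gap_set[OF assms]])
  finally have "(q_rf ^ b - 1) / of_nat b *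
      (\<Sum>j = 0..b - 1. d_sum j q_rf t_rf a b *
         gap_poly a b (const_rf (root_eps b ^ j) * q_rf)) =
    (\<Sum>k = 1..b - 1. t_rf ^ (k - 1) / q_rf ^ rem_pi a b k * ((q_rf ^ b - 1) * ?gaps k))"
    using of_nat_ratfun_nonzero[OF assms(2)] by (simp add: sum_distrib_left mult_ac)
  also have "\<dots> = (\<Sum>k = 1..b - 1. t_rf ^ (k - 1) * ((q_rf ^ b) ^ (a * k div b) - 1))"
  proof (intro sum.cong refl)
    fix k assume "k \<in> {1..b - 1}"
    hence "k < b" by auto
    from gap_sum_residue_class[OF assms(3) this q_rf_power_neq_1[OF assms(2)]]
    show "t_rf ^ (k - 1) / q_rf ^ rem_pi a b k * ((q_rf ^ b - 1) * ?gaps k) =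
        t_rf ^ (k - 1) * ((q_rf ^ b) ^ (a * k div b) - 1)"
      using q_rf_nonzero by simp
  qed
  also have "\<dots> = dedekind_carlitz (q_rf ^ b) t_rf a b - (\<Sum>k = 1..b - 1. t_rf ^ (k - 1))"
    by (simp add: dedekind_carlitz_def floor_divide_of_nat_eq algebra_simps sum_subtractf
        del: of_nat_mult)
  also have "(\<Sum>k = 1..b - 1. t_rf ^ (k - 1)) = (\<Sum>i<b - 1. t_rf ^ i)"
    by (rule sum.reindex_bij_witness[of _ Suc "\<lambda>k. k - 1"]) auto
  also have "\<dots> = (t_rf ^ (b - 1) - 1) / (t_rf - 1)"
    by (rule geometric_sum[OF t_rf_neq_1])
  finally show ?thesis by simp
qed

end
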